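(* Let $G$ be a finite simple graph. Then $G$ is a square geometric graph if and only if there exist two linear orderings $<_1$ and $<_2$ on $V(G)$ such that for all $u,v,x,y,a,b\in V(G)$ the following implication holds: if $u<_1 a<_1 v$, $u<_1 b<_1 v$, $u\sim v$, and $x<_2 a<_2 y$, $x<_2 b<_2 y$, $x\sim y$, then $a\sim b$.
   Context: $u\sim v$ means that $u$ and $v$ are adjacent in $G$. A graph $G$ is square geometric (i.e. an $(\mathbb{R}^2,\|\cdot\|_\infty)$-geometric graph) if there is a map $p:V(G)\to\mathbb{R}^2$ such that two distinct vertices $u,v$ are adjacent if and only if $\|p(u)-p(v)\|_\infty\le 1$, where $\|(z_1,z_2)\|_\infty=\max(|z_1|,|z_2|)$.
   Formalization: The inequalities in both linear orderings are read as weak (≤), and a, b are required to be distinct; with strict inequalities the claim fails for K_5 when a = b is allowed, and for K_{1,5} even when a ≠ b is required. *)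

theory Defs
  imports "HOL-Analysis.Analysis" "Graph_Theory.Digraph"
begin

definition square_geometric :: "('a, 'b) pre_digraph \<Rightarrow> bool" where
  "square_geometric G \<longleftrightarrow>
     (\<exists>p :: 'a \<Rightarrow> real ^ 2. \<forall>u \<in> verts G. \<forall>v \<in> verts G.
        u \<noteq> v \<longrightarrow> (u \<rightarrow>\<^bsub>G\<^esub> v \<longleftrightarrow> infnorm (p u - p v) \<le> 1))"

end

theory Submission
  imports Defs
begin

text \<open>If two vertices are sandwiched, in one ordering, between the ends of an edge, then their
  coordinates differ by at most 1; so sorting by the two coordinates (ties broken arbitrarily)
  gives the orderings. Conversely, call two vertices \<open>i\<close>-close if both lie, with respect to the
  \<open>i\<close>-th ordering, between the ends of an edge. Adjacency is the conjunction of 1-closeness and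
  2-closeness. Closeness has the umbrella property of indifference graphs, so inserting the vertices
  in increasing order one can choose for each of them a real number that lies above all
  earlier ones and within distance less than 1 of exactly the earlier vertices close to it.\<close>

lemma infnorm_le_iff_2:
  fixes z :: "real ^ 2"
  shows "infnorm z \<le> c \<longleftrightarrow> \<bar>z $ 1\<bar> \<le> c \<and> \<bar>z $ 2\<bar> \<le> c"
proof -
  have "{\<bar>z $ i\<bar> |i. i \<in> UNIV} = {\<bar>z $ 1\<bar>, \<bar>z $ 2\<bar>}"
    by (auto simp: UNIV_2)
  then have "infnorm z = Sup {\<bar>z $ 1\<bar>, \<bar>z $ 2\<bar>}"
    by (simp only: infnorm_cart)
  also have "\<dots> = max \<bar>z $ 1\<bar> \<bar>z $ 2\<bar>"
    by (simp add: cSup_eq_Max)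
  finally show ?thesis
    by simp
qed

text \<open>Density gives a point between \<open>Max L\<close> and \<open>Min U\<close>; when one of
  these bounds is missing because its set is empty, unboundedness of the order replaces
  density.\<close>

lemma finite_sets_separated:
  fixes L U :: "'a :: unbounded_dense_linorder set"
  assumes "finite L" "finite U" and less: "\<And>l u. l \<in> L \<Longrightarrow> u \<in> U \<Longrightarrow> l < u"
  shows "\<exists>c. (\<forall>l\<in>L. l < c) \<and> (\<forall>u\<in>U. c < u)"
proof -
  consider "L = {}" "U = {}" | "L = {}" "U \<noteq> {}" | "L \<noteq> {}" "U = {}" | "L \<noteq> {}" "U \<noteq> {}"
    by blast
  then show ?thesis
  proof cases
    case 1
    then show ?thesis by simp
  next
    case 2
    obtain c where "c < Min U"
      using lt_ex by blast
    then show ?thesis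
      using 2 assms(2) by auto
  next
    case 3
    obtain c where "Max L < c"
      using gt_ex by blast
    then show ?thesis
      using 3 assms(1) by auto
  next
    case 4
    then have "Max L < Min U"
      using assms by simp
    then obtain c where "Max L < c" "c < Min U"
      using dense by blast
    then show ?thesis
      using 4 assms(1,2) by auto
  qed
qed

text \<open>The vertex of largest rank is added last, and its value has to meet finitely many strict
  lower and upper bounds, which turn out to be compatible. Avoiding distance exactly 1 keeps the
  induction going: if \<open>f s = f t + 1\<close> were allowed for a related pair, no value above
  \<open>f s\<close> and below \<open>f t + 1\<close> would be left for a new vertex.\<close>

lemma umbrella_order_indifference_representation:
  fixes h :: "'a \<Rightarrow> nat" and E :: "'a \<Rightarrow> 'a \<Rightarrow> bool"
  assumes "finite A" "inj_on h A"
    and "\<And>u a b v. \<lbrakk>u \<in> A; a \<in> A; b \<in> A; v \<in> A; h u \<le> h a; h a < h b; h b \<le> h v; E u v\<rbrakk> \<Longrightarrow> E a b"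
  shows "\<exists>f :: 'a \<Rightarrow> real. \<forall>a\<in>A. \<forall>b\<in>A. h a < h b \<longrightarrow>
           f a < f b \<and> (E a b \<longrightarrow> f b < f a + 1) \<and> (\<not> E a b \<longrightarrow> f a + 1 < f b)"
  using assms
proof (induction A rule: finite_ranking_induct[where f = h])
  case empty
  then show ?case by simp
next
  case (insert x S)
  note umbrella = insert.prems(2)
  have "inj_on h S"
    using insert.prems(1) by (auto intro: inj_on_subset)
  moreover have "E a b" if "u \<in> S" "a \<in> S" "b \<in> S" "v \<in> S" "h u \<le> h a" "h a < h b" "h b \<le> h v" "E u v"
    for u a b v
    using umbrella[of u a b v] that by blast
  ultimately obtain f :: "'a \<Rightarrow> real" where f: "\<And>a b. \<lbrakk>a \<in> S; b \<in> S; h a < h b\<rbrakk> \<Longrightarrow>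
      f a < f b \<and> (E a b \<longrightarrow> f b < f a + 1) \<and> (\<not> E a b \<longrightarrow> f a + 1 < f b)"
    using insert.IH by blast
  show ?case
  \<comment> \<open>The ranking induction does not say that \<open>x\<close> is new, and bounds the
    ranks in \<open>S\<close> by \<open>h x\<close> only weakly; for a new \<open>x\<close>,
    injectivity makes the bound strict.\<close>
  proof (cases "x \<in> S")
    case True
    then show ?thesis
      using f by (metis insert_absorb)
  next
    case False
    have below: "h s < h x" if "s \<in> S" for s
      using insert.hyps(2)[OF that] insert.prems(1) False that
      by (metis inj_on_def insertCI order_le_less)
    have inj: "s = t" if "s \<in> S" "t \<in> S" "h s = h t" for s t
      using \<open>inj_on h S\<close> that by (auto dest: inj_onD)
    \<comment> \<open>The value of \<open>x\<close> must exceed all earlier values, exceed by more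
      than 1 those of vertices unrelated to \<open>x\<close>, and stay less than 1 above those of
      related vertices.\<close>
    define L where "L = f ` S \<union> (\<lambda>s. f s + 1) ` {s \<in> S. \<not> E s x}"
    define U where "U = (\<lambda>t. f t + 1) ` {t \<in> S. E t x}"
    \<comment> \<open>If \<open>s\<close> comes after \<open>t\<close>, it lies under the umbrella
      from \<open>t\<close> to \<open>x\<close>, so \<open>t\<close> is related to \<open>s\<close>
      and the bound for \<open>f\<close> on \<open>S\<close> applies; otherwise
      \<open>f s \<le> f t\<close>.\<close>
    have 1: "f s < f t + 1" if "s \<in> S" "t \<in> S" "E t x" for s t
    proof (cases "h t < h s")
      case True
      then have "E t s"
        using umbrella[of t t s x] that below[of s] by simp
      then show ?thesis
        using f that True by blast
    next
      case False
      then show ?thesis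
        using f[of s t] inj[of s t] that by (cases "h s = h t") auto
    qed
    \<comment> \<open>Were \<open>t\<close> not after \<open>s\<close>, the umbrella from
      \<open>t\<close> to \<open>x\<close> would cover \<open>s\<close> and relate it to
      \<open>x\<close>.\<close>
    have 2: "f s + 1 < f t + 1" if "s \<in> S" "\<not> E s x" "t \<in> S" "E t x" for s t
    proof -
      have "h s < h t"
        using umbrella[of t s x x] that below[of s] by (meson insertCI not_le order_refl)
      then show ?thesis
        using f that by simp
    qed
    have "\<exists>c. (\<forall>l\<in>L. l < c) \<and> (\<forall>u\<in>U. c < u)"
      using insert.hyps(1) 1 2 by (intro finite_sets_separated) (auto simp: L_def U_def)
    then obtain c where c: "\<And>s. s \<in> S \<Longrightarrow> f s < c"
      "\<And>s. s \<in> S \<Longrightarrow> \<not> E s x \<Longrightarrow> f s + 1 < c" "\<And>s. s \<in> S \<Longrightarrow> E s x \<Longrightarrow> c < f s + 1"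
      unfolding L_def U_def by blast
    show ?thesis
    proof (intro exI[of _ "f(x := c)"] ballI impI)
      fix a b
      assume ab: "a \<in> insert x S" "b \<in> insert x S" "h a < h b"
      then have a: "a \<in> S" "a \<noteq> x"
        using below False by fastforce+
      show "(f(x := c)) a < (f(x := c)) b \<and>
          (E a b \<longrightarrow> (f(x := c)) b < (f(x := c)) a + 1) \<and>
          (\<not> E a b \<longrightarrow> (f(x := c)) a + 1 < (f(x := c)) b)"
        using a ab c[of a] f[of a b] by (cases "b = x") simp_all
    qed
  qed
qed

text \<open>The rank of an element is the number of its predecessors, itself included. Passing to a
  strictly larger element \<open>b\<close> keeps all predecessors by transitivity and adds
  \<open>b\<close> itself.\<close>

lemma finite_linear_order_rank:
  assumes "finite A" "linear_order_on A r"
  obtains h :: "'a \<Rightarrow> nat"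
  where "inj_on h A" "\<And>a b. a \<in> A \<Longrightarrow> b \<in> A \<Longrightarrow> (a, b) \<in> r \<longleftrightarrow> h a \<le> h b"
proof
  define h where "h a = card {c \<in> A. (c, a) \<in> r}" for a
  have refl: "\<And>a. a \<in> A \<Longrightarrow> (a, a) \<in> r" and tr: "trans r" and anti: "antisym r"
    using assms(2) by (auto simp: order_on_defs refl_on_def)
  then have tot: "(a, b) \<in> r \<or> (b, a) \<in> r" if "a \<in> A" "b \<in> A" for a b
    using assms(2) that by (cases "a = b") (auto simp: order_on_defs total_on_def)
  have le: "h a \<le> h b" if "(a, b) \<in> r" for a b
    unfolding h_def using that assms(1) tr by (intro card_mono) (auto dest: transD)
  have less: "h a < h b" if "a \<in> A" "b \<in> A" "(a, b) \<in> r" "a \<noteq> b" for a b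
  proof -
    have "(b, a) \<notin> r"
      using that anti by (auto dest: antisymD)
    then have "{c \<in> A. (c, a) \<in> r} \<subset> {c \<in> A. (c, b) \<in> r}"
      using that tr refl by (auto dest: transD)
    then show ?thesis
      unfolding h_def using assms(1) by (intro psubset_card_mono) auto
  qed
  show "inj_on h A"
    using less tot by (metis inj_onI less_irrefl)
  show "(a, b) \<in> r \<longleftrightarrow> h a \<le> h b" if "a \<in> A" "b \<in> A" for a b
    using le less tot refl that by (metis not_le)
qed

text \<open>Closeness has the umbrella property because an edge enclosing two vertices also encloses
  everything between them. The vertices are taken distinct since an isolated vertex need not be
  close to itself.\<close>

lemma linear_order_closeness_representation:
  fixes adj :: "'a \<Rightarrow> 'a \<Rightarrow> bool"
  assumes "finite A" "linear_order_on A r"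
  obtains f :: "'a \<Rightarrow> real"
  where "\<And>a b. a \<in> A \<Longrightarrow> b \<in> A \<Longrightarrow> a \<noteq> b \<Longrightarrow> \<bar>f a - f b\<bar> \<le> 1 \<longleftrightarrow>
    (\<exists>u\<in>A. \<exists>v\<in>A. (u, a) \<in> r \<and> (a, v) \<in> r \<and> (u, b) \<in> r \<and> (b, v) \<in> r \<and> adj u v)"
proof -
  define E where "E a b \<longleftrightarrow>
    (\<exists>u\<in>A. \<exists>v\<in>A. (u, a) \<in> r \<and> (a, v) \<in> r \<and> (u, b) \<in> r \<and> (b, v) \<in> r \<and> adj u v)" for a b
  obtain h :: "'a \<Rightarrow> nat" where inj: "inj_on h A"
    and h: "\<And>a b. a \<in> A \<Longrightarrow> b \<in> A \<Longrightarrow> (a, b) \<in> r \<longleftrightarrow> h a \<le> h b"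
    using finite_linear_order_rank[OF assms] by blast
  have "E a b" if "u \<in> A" "a \<in> A" "b \<in> A" "v \<in> A" "h u \<le> h a" "h a < h b" "h b \<le> h v" "E u v"
    for u a b v
  proof -
    obtain s t where st: "s \<in> A" "t \<in> A" "h s \<le> h u" "h v \<le> h t" "adj s t"
      using \<open>E u v\<close> \<open>u \<in> A\<close> \<open>v \<in> A\<close> h unfolding E_def by blast
    have "h s \<le> h a" "h a \<le> h t" "h s \<le> h b" "h b \<le> h t"
      using st that by linarith+
    then show ?thesis
      unfolding E_def using st that(2,3) h by blast
  qed
  then obtain f :: "'a \<Rightarrow> real" where f: "\<And>a b. \<lbrakk>a \<in> A; b \<in> A; h a < h b\<rbrakk> \<Longrightarrow>
      f a < f b \<and> (E a b \<longrightarrow> f b < f a + 1) \<and> (\<not> E a b \<longrightarrow> f a + 1 < f b)"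
    using umbrella_order_indifference_representation[of A h E] assms(1) inj by blast
  have E_sym: "E a b = E b a" for a b
    unfolding E_def by blast
  have "\<bar>f a - f b\<bar> \<le> 1 \<longleftrightarrow> E a b" if "a \<in> A" "b \<in> A" "a \<noteq> b" for a b
  proof -
    have "h a < h b \<or> h b < h a"
      using inj that by (metis inj_onD nat_neq_iff)
    \<comment> \<open>Either vertex may come first, and as the distance is never exactly 1, the
      strict bounds decide the weak one.\<close>
    then show ?thesis
      using f[of a b] f[of b a] that(1,2) E_sym[of a b] by (cases "E a b") auto
  qed
  then show thesis
    using that unfolding E_def by blast
qed

text \<open>The order is lexicographic: first by \<open>f\<close>, then by an injective numbering
  that breaks ties.\<close>

lemma linear_order_refining_real_function:
  fixes f :: "'a \<Rightarrow> real"
  assumes "finite A"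
  obtains r where "linear_order_on A r" "\<And>a b. (a, b) \<in> r \<Longrightarrow> f a \<le> f b"
proof -
  obtain g :: "'a \<Rightarrow> nat" where g: "inj_on g A"
    using finite_imp_inj_to_nat_seg[OF assms] by blast
  define r where "r = {(a, b). a \<in> A \<and> b \<in> A \<and> (f a < f b \<or> f a = f b \<and> g a \<le> g b)}"
  have "linear_order_on A r"
    unfolding order_on_defs
  proof (intro conjI)
    show "antisym r"
      using g by (auto simp: r_def antisym_def inj_on_def)
  qed (auto simp: r_def refl_on_def trans_def total_on_def)
  then show thesis
    by (rule that) (auto simp: r_def)
qed

theorem theorem2p1:
  fixes G :: "('a, 'b) pre_digraph"
  assumes "graph G"
  shows "square_geometric G \<longleftrightarrow>
    (\<exists>r1 r2 :: 'a rel. linear_order_on (verts G) r1 \<and> linear_order_on (verts G) r2 \<and>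
      (\<forall>u \<in> verts G. \<forall>v \<in> verts G. \<forall>x \<in> verts G. \<forall>y \<in> verts G.
       \<forall>a \<in> verts G. \<forall>b \<in> verts G. a \<noteq> b \<longrightarrow>
         (u, a) \<in> r1 \<and> (a, v) \<in> r1 \<and> (u, b) \<in> r1 \<and> (b, v) \<in> r1 \<and> u \<rightarrow>\<^bsub>G\<^esub> v \<and>
         (x, a) \<in> r2 \<and> (a, y) \<in> r2 \<and> (x, b) \<in> r2 \<and> (b, y) \<in> r2 \<and> x \<rightarrow>\<^bsub>G\<^esub> y
         \<longrightarrow> a \<rightarrow>\<^bsub>G\<^esub> b))"
    (is "_ \<longleftrightarrow> (\<exists>r1 r2. ?L r1 \<and> ?L r2 \<and> ?sandwich r1 r2)")
proof
  interpret graph G by fact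
  {
    assume "square_geometric G"
    then obtain p :: "'a \<Rightarrow> real ^ 2" where p: "\<And>u v. \<lbrakk>u \<in> verts G; v \<in> verts G; u \<noteq> v\<rbrakk> \<Longrightarrow>
        u \<rightarrow>\<^bsub>G\<^esub> v \<longleftrightarrow> \<bar>p u $ 1 - p v $ 1\<bar> \<le> 1 \<and> \<bar>p u $ 2 - p v $ 2\<bar> \<le> 1"
      unfolding square_geometric_def infnorm_le_iff_2 by auto
    obtain r1 where r1: "?L r1" "\<And>a b. (a, b) \<in> r1 \<Longrightarrow> p a $ 1 \<le> p b $ 1"
      using linear_order_refining_real_function[OF finite_verts, of "\<lambda>a. p a $ 1"] by blast
    obtain r2 where r2: "?L r2" "\<And>a b. (a, b) \<in> r2 \<Longrightarrow> p a $ 2 \<le> p b $ 2"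
      using linear_order_refining_real_function[OF finite_verts, of "\<lambda>a. p a $ 2"] by blast
    \<comment> \<open>Since \<open>p\<close> speaks of distinct vertices only, equal ends are
      treated apart; there the differences are 0.\<close>
    have edge: "\<bar>p u $ 1 - p v $ 1\<bar> \<le> 1 \<and> \<bar>p u $ 2 - p v $ 2\<bar> \<le> 1" if "u \<rightarrow>\<^bsub>G\<^esub> v" for u v
      using p[of u v] that adj_in_verts[OF that] by (cases "u = v") auto
    have "a \<rightarrow>\<^bsub>G\<^esub> b"
      if "a \<in> verts G" "b \<in> verts G" "a \<noteq> b"
        "(u, a) \<in> r1" "(a, v) \<in> r1" "(u, b) \<in> r1" "(b, v) \<in> r1" "u \<rightarrow>\<^bsub>G\<^esub> v"
        "(x, a) \<in> r2" "(a, y) \<in> r2" "(x, b) \<in> r2" "(b, y) \<in> r2" "x \<rightarrow>\<^bsub>G\<^esub> y" for u v x y a b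
    proof -
      \<comment> \<open>Both values lie between those of \<open>u\<close> and \<open>v\<close>,
        which are at most 1 apart.\<close>
      have "\<bar>p a $ 1 - p b $ 1\<bar> \<le> 1"
        using that(4-7)[THEN r1(2)] edge[OF that(8)] by linarith
      moreover have "\<bar>p a $ 2 - p b $ 2\<bar> \<le> 1"
        using that(9-12)[THEN r2(2)] edge[OF that(13)] by linarith
      ultimately show ?thesis
        using p that by blast
    qed
    then have "?sandwich r1 r2"
      by blast
    then show "\<exists>r1 r2. ?L r1 \<and> ?L r2 \<and> ?sandwich r1 r2"
      using r1(1) r2(1) by blast
  }
  assume "\<exists>r1 r2. ?L r1 \<and> ?L r2 \<and> ?sandwich r1 r2"
  then obtain r1 r2 where r: "?L r1" "?L r2" and sandwich: "?sandwich r1 r2"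
    by (elim exE conjE)
  define close where "close r a b \<longleftrightarrow> (\<exists>u\<in>verts G. \<exists>v\<in>verts G.
    (u, a) \<in> r \<and> (a, v) \<in> r \<and> (u, b) \<in> r \<and> (b, v) \<in> r \<and> u \<rightarrow>\<^bsub>G\<^esub> v)" for r :: "'a rel" and a b
  obtain f1 :: "'a \<Rightarrow> real" where f1: "\<And>a b. \<lbrakk>a \<in> verts G; b \<in> verts G; a \<noteq> b\<rbrakk> \<Longrightarrow>
      \<bar>f1 a - f1 b\<bar> \<le> 1 \<longleftrightarrow> close r1 a b"
    using linear_order_closeness_representation[OF finite_verts r(1), of "\<lambda>u v. u \<rightarrow>\<^bsub>G\<^esub> v"]
    unfolding close_def by blast
  obtain f2 :: "'a \<Rightarrow> real" where f2: "\<And>a b. \<lbrakk>a \<in> verts G; b \<in> verts G; a \<noteq> b\<rbrakk> \<Longrightarrow>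
      \<bar>f2 a - f2 b\<bar> \<le> 1 \<longleftrightarrow> close r2 a b"
    using linear_order_closeness_representation[OF finite_verts r(2), of "\<lambda>u v. u \<rightarrow>\<^bsub>G\<^esub> v"]
    unfolding close_def by blast
  \<comment> \<open>An edge encloses its own ends, as the orders are reflexive. Either end may be
    the lower one, so symmetry of adjacency supplies the edge in the required direction.\<close>
  have adj_close: "close r a b" if "?L r" "a \<rightarrow>\<^bsub>G\<^esub> b" for r a b
  proof -
    have ab: "a \<in> verts G" "b \<in> verts G" "b \<rightarrow>\<^bsub>G\<^esub> a"
      using that(2) adj_in_verts by (auto intro: arcs_ends_symmetric[OF sym_arcs])
    moreover have "(a, a) \<in> r" "(b, b) \<in> r"
      using that(1) ab by (auto simp: order_on_defs refl_on_def)
    moreover from this have "(a, b) \<in> r \<or> (b, a) \<in> r"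
      using that(1) ab by (cases "a = b") (auto simp: order_on_defs total_on_def)
    ultimately show ?thesis
      unfolding close_def using that(2) by blast
  qed
  have "a \<rightarrow>\<^bsub>G\<^esub> b \<longleftrightarrow> close r1 a b \<and> close r2 a b" if "a \<in> verts G" "b \<in> verts G" "a \<noteq> b" for a b
  proof
    assume "close r1 a b \<and> close r2 a b"
    then show "a \<rightarrow>\<^bsub>G\<^esub> b"
      unfolding close_def using sandwich that by blast
  qed (use adj_close r in blast)
  \<comment> \<open>Each coordinate represents one closeness relation, and the maximum norm turns
    their conjunction into a single distance condition.\<close>
  then show "square_geometric G"
    unfolding square_geometric_def infnorm_le_iff_2
    by (intro exI[of _ "\<lambda>a. vector [f1 a, f2 a]"]) (simp add: f1 f2)
qed

end
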